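(* Let $N_i=4^{i+1}$ for $i\ge 1$ and $h(n)=\lfloor n\cdot 10^{-8}\rfloor$. Let $\mathcal{S}$ be a selection mechanism which, for each $k\ge 1$ and any given sets of integers $B_i,C_i,G_i,H_i$ ($1\le i\le k-1$), produces sets $$G_k\subseteq \bigcup_{i=1}^{k-1}\bigl(B_i\cup(N_{i+1}-G_i)\bigr),\qquad H_k\subseteq \bigcup_{i=1}^{k-1}\bigl(C_i\cup(N_{i+1}-H_i)\bigr).$$ Suppose that for all $k$ and all inputs, $G_k$ and $H_k$ are disjoint and no element of $F_k:=G_k\cup H_k$ is greater than $N_k$. Then there exist sets $B_1,B_2,\ldots$ and $C_1,C_2,\ldots$ such that, letting $G_k,H_k$ be the outputs of $\mathcal{S}$ on these inputs (including the previously produced $G_i,H_i$ for $i<k$), the sets $$B:=\bigcup_{i=1}^{\infty}\bigl(B_i\cup(N_{i+1}-G_i)\bigr),\qquad C:=\bigcup_{i=1}^{\infty}\bigl(C_i\cup(N_{i+1}-H_i)\bigr)$$ satisfy: 1. each $B_k$ and each $C_k$ consists of positive integers strictly between $N_k$ and $N_{k+1}$; 2. $B\cap C=\emptyset$; 3. $r'_B(n)\ge h(n)$ and $r'_C(n)\ge h(n)$ for all sufficiently large $n\in\mathbb{N}\setminus\{N_i: i\ge 1\}$; 4. for all sufficiently large $k$, every representation $N_{k+1}=a+a'$ with $a,a'\in B\cup C$ has $a\in F_k$ or $a'\in F_k$.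
   Context: For a set $S$ of integers and an integer $m$, $m-S=\{m-s: s\in S\}$. For $A\subseteq\mathbb{N}$, $r'_A(n)$ denotes the number of pairs $(a,a')\in A^2$ with $a+a'=n$ and $a'/a\in[1,100]$. *)

theory Defs
  imports Complex_Main
begin

definition N :: "nat \<Rightarrow> int" where
  "N i = 4 ^ (i + 1)"

definition h :: "nat \<Rightarrow> int" where
  "h n = \<lfloor>real n * 10 powi (-8)\<rfloor>"

definition reflect :: "int \<Rightarrow> int set \<Rightarrow> int set" where
  "reflect m S = {m - s | s. s \<in> S}"

text \<open>Meant for sets \<^term>\<open>A\<close> of nonnegative integers. The ratio condition excludes \<open>a = 0\<close>
  (as \<open>x / 0 = 0\<close>) and forces equal signs, so the counted set is finite for every \<^term>\<open>A\<close>.\<close>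

definition r' :: "int set \<Rightarrow> nat \<Rightarrow> nat" where
  "r' A n = card {(a, a'). a \<in> A \<and> a' \<in> A \<and> a + a' = int n \<and>
                           real_of_int a' / real_of_int a \<in> {1..100}}"

definition assemble :: "nat set \<Rightarrow> (nat \<Rightarrow> int set) \<Rightarrow> (nat \<Rightarrow> int set) \<Rightarrow> int set" where
  "assemble I X Y = (\<Union>i\<in>I. X i \<union> reflect (N (i + 1)) (Y i))"

text \<open>\<open>S k B C G H\<close> is the pair \<open>(G\<^sub>k, H\<^sub>k)\<close>. The inputs are passed as whole sequences; the first
  conjunct below says that only the entries with \<open>1 \<le> i \<le> k - 1\<close> are used.\<close>

type_synonym selection =
  "nat \<Rightarrow> (nat \<Rightarrow> int set) \<Rightarrow> (nat \<Rightarrow> int set) \<Rightarrow> (nat \<Rightarrow> int set) \<Rightarrow> (nat \<Rightarrow> int set)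
     \<Rightarrow> int set \<times> int set"

definition selection_mechanism :: "selection \<Rightarrow> bool" where
  "selection_mechanism S \<longleftrightarrow>
     (\<forall>k\<ge>1. \<forall>B C G H B' C' G' H'.
        (\<forall>i\<in>{1..<k}. B i = B' i \<and> C i = C' i \<and> G i = G' i \<and> H i = H' i) \<longrightarrow>
        S k B C G H = S k B' C' G' H') \<and>
     (\<forall>k\<ge>1. \<forall>B C G H.
        fst (S k B C G H) \<subseteq> assemble {1..<k} B G \<and>
        snd (S k B C G H) \<subseteq> assemble {1..<k} C H)"

end

theory Submission
  imports Defs "HOL-Number_Theory.Cong"
begin

text \<open>The adversary \<open>S\<close> cannot interfere with a suitable choice of \<open>B\<^sub>k\<close> and \<open>C\<^sub>k\<close> made in advance.
  Write \<open>M = N\<^sub>k\<close>. If \<open>B\<^sub>k\<close> and \<open>C\<^sub>k\<close> lie in \<open>(M, 3M)\<close>, are disjoint and together contain at most one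
  of \<open>x\<close> and \<open>4M - x\<close> for every \<open>x\<close>, then the reflected sets live in \<open>[3M, 4M)\<close>, whence conditions 1, 2
  and 4, and adding them can only increase \<open>r'\<close>.

  For condition 3, three intervals of \<open>(M, 3M)\<close> are divided between \<open>B\<^sub>k\<close> and \<open>C\<^sub>k\<close> by residues
  modulo 8, using a partition of the residues into two additive bases of order 2. Sums of these
  intervals, from the same or from nearby levels, account for all \<open>n\<close> except those very near
  \<open>4M\<close>. To represent \<open>4M + s\<close> with \<open>s \<noteq> 0\<close> small, each pair \<open>2M + u\<close>, \<open>2M - u\<close> with
  \<open>0 < u < M/8\<close> contributes one element to one of the two sets, as dictated by the binary digit sum
  of \<open>u\<close> modulo 4. The digit sums of \<open>u\<close> and \<open>u + s\<close> take each pair of values modulo 4 for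
  a positive proportion of \<open>u\<close>, uniformly in \<open>s\<close>.\<close>

section \<open>Binary digit sums\<close>

fun digit_sum :: "nat \<Rightarrow> nat" where
  "digit_sum n = (if n = 0 then 0 else n mod 2 + digit_sum (n div 2))"

declare digit_sum.simps [simp del]

lemma digit_sum_0 [simp]: "digit_sum 0 = 0"
  by (simp add: digit_sum.simps)

lemma digit_sum_rec: "digit_sum n = n mod 2 + digit_sum (n div 2)"
  by (cases "n = 0") (simp_all add: digit_sum.simps[of n])

lemma digit_sum_add_power:
  "v < 2 ^ L \<Longrightarrow> digit_sum (v + 2 ^ L * w) = digit_sum v + digit_sum w"
proof (induction L arbitrary: v)
  case (Suc L)
  have "(v + 2 ^ Suc L * w) div 2 = v div 2 + 2 ^ L * w"
    by (simp add: mult.assoc)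
  moreover have "(v + 2 ^ Suc L * w) mod 2 = v mod 2"
    by (simp add: mult.assoc)
  moreover have "digit_sum (v div 2 + 2 ^ L * w) = digit_sum (v div 2) + digit_sum w"
    using Suc.prems by (intro Suc.IH) auto
  ultimately show ?case
    using digit_sum_rec[of "v + 2 ^ Suc L * w"] digit_sum_rec[of v] by simp
qed simp

lemma digit_sum_numerals:
  "digit_sum 1 = 1" "digit_sum 2 = 1" "digit_sum 3 = 2" "digit_sum 4 = 1" "digit_sum 7 = 3"
  "digit_sum 8 = 1"
  by (simp_all add: digit_sum.simps)

lemma ex_shift_mod_4: "\<exists>i\<in>{0, 1, 2, 3}. (d + i) mod 4 = r" if "r < 4" for d r :: nat
proof
  have "(d + (r + 3 * d) mod 4) mod 4 = (r + 4 * d) mod 4"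
    by (simp add: mod_add_right_eq add.commute)
  then show "(d + (r + 3 * d) mod 4) mod 4 = r"
    using that by simp
  have "(r + 3 * d) mod 4 < 4" by simp
  then show "(r + 3 * d) mod 4 \<in> {0, 1, 2, 3}" by force
qed

text \<open>Three binary digits suffice: \<open>0, 1, 3, 7\<close> have digit sums 0, 1, 2,
  3.\<close>

lemma ex_digit_sum_mod_4: "\<exists>z<8. (d + digit_sum z) mod 4 = r" if "r < 4" for d r :: nat
proof -
  have "(d + digit_sum 0) mod 4 = r \<or> (d + digit_sum 1) mod 4 = r
      \<or> (d + digit_sum 3) mod 4 = r \<or> (d + digit_sum 7) mod 4 = r"
    using ex_shift_mod_4[OF that, of d] by (auto simp: digit_sum_numerals simp del: One_nat_def)
  moreover have "0 < (8::nat)" "1 < (8::nat)" "3 < (8::nat)" "7 < (8::nat)"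
    by simp_all
  ultimately show ?thesis by blast
qed

text \<open>Adding 1 turns \<open>j\<close> trailing ones into zeros; \<open>y = 0, 1, 3, 7\<close> realise \<open>j = 0, 1, 2, 3\<close>.\<close>

lemma ex_digit_sum_Suc_mod_4:
  "\<exists>y<8. (d + digit_sum (y + 1)) mod 4 = (e + digit_sum y) mod 4" for d e :: nat
proof -
  have "(d + 1) mod 4 < 4" by simp
  from ex_shift_mod_4[OF this] obtain i where "i \<in> {0, 1, 2, 3}" "(e + i) mod 4 = (d + 1) mod 4"
    by blast
  then have "(d + digit_sum (0 + 1)) mod 4 = (e + digit_sum 0) mod 4
      \<or> (d + digit_sum (1 + 1)) mod 4 = (e + digit_sum 1) mod 4
      \<or> (d + digit_sum (3 + 1)) mod 4 = (e + digit_sum 3) mod 4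
      \<or> (d + digit_sum (7 + 1)) mod 4 = (e + digit_sum 7) mod 4"
    by (auto simp: digit_sum_numerals simp del: One_nat_def)
  moreover have "0 < (8::nat)" "1 < (8::nat)" "3 < (8::nat)" "7 < (8::nat)"
    by simp_all
  ultimately show ?thesis by blast
qed

text \<open>With \<open>2 ^ (L - 1) \<le> s < 2 ^ L\<close>, a proportion of at least a half of the residues \<open>v\<close> modulo
  \<open>2 ^ L\<close> produce a carry out of the last \<open>L\<close> digits when \<open>s\<close> is added. The seven digits after
  that can be chosen to give both digit sums prescribed values modulo 4.\<close>

lemma ex_digit_sums_in_block:
  fixes s v q :: nat
  assumes "s < 2 ^ L" "2 ^ L \<le> v + s" "v < 2 ^ L" "\<alpha> < 4" "\<beta> < 4"
  shows "\<exists>u. u mod 2 ^ L = v \<and> u div 2 ^ (L + 7) = q \<and>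
    digit_sum u mod 4 = \<alpha> \<and> digit_sum (u + s) mod 4 = \<beta>"
proof -
  \<comment> \<open>After the carry, \<open>c\<close> is what the last \<open>L\<close> digits of
    \<open>u + s\<close> hold.\<close>
  define c where "c = v + s - 2 ^ L"
  have c: "c < 2 ^ L" "v + s = c + 2 ^ L"
    using assms by (auto simp: c_def)
  \<comment> \<open>As \<open>y + 1 < 16\<close>, the carry stops within the four digits given to
    \<open>y\<close>. The choice of \<open>y\<close> adjusts the difference of the two digit sums;
    \<open>z\<close>, shared by \<open>u\<close> and \<open>u + s\<close>, then adjusts both at
    once.\<close>
  obtain y where y: "y < 8"
    "(digit_sum c + \<alpha> + digit_sum (y + 1)) mod 4 = (digit_sum v + \<beta> + digit_sum y) mod 4"
    using ex_digit_sum_Suc_mod_4 by blast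
  obtain z where z: "z < 8" "(digit_sum v + digit_sum y + digit_sum q + digit_sum z) mod 4 = \<alpha>"
    using ex_digit_sum_mod_4[OF \<open>\<alpha> < 4\<close>] by blast
  have *: "digit_sum (x + 2 ^ L * (y' + 16 * (z + 8 * q)))
      = digit_sum x + digit_sum y' + digit_sum z + digit_sum q"
    if "x < 2 ^ L" "y' < 16" for x y'
    using digit_sum_add_power[OF that(1), of "y' + 16 * (z + 8 * q)"]
      digit_sum_add_power[of y' 4 "z + 8 * q"] digit_sum_add_power[of z 3 q] that z(1) by simp
  let ?u = "v + 2 ^ L * (y + 16 * (z + 8 * q))"
  have u1: "?u mod 2 ^ L = v"
    using assms by simp
  have "?u div 2 ^ (L + 7) = ?u div 2 ^ L div 128"
    by (simp add: power_add div_mult2_eq)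
  also have "\<dots> = q"
    using assms y z by simp
  finally have u2: "?u div 2 ^ (L + 7) = q" .
  have u3: "digit_sum ?u = digit_sum v + digit_sum y + digit_sum z + digit_sum q"
    using * assms y by simp
  have "?u + s = c + 2 ^ L * ((y + 1) + 16 * (z + 8 * q))"
    using c by (simp add: algebra_simps)
  then have u4: "digit_sum (?u + s) = digit_sum c + digit_sum (y + 1) + digit_sum z + digit_sum q"
    using *[OF c(1), of "y + 1"] y(1) by (simp only:)
  let ?X = "digit_sum c + digit_sum (y + 1)" and ?Y = "digit_sum v + digit_sum y"
    and ?Z = "digit_sum z + digit_sum q"
  have Z: "(?Y + ?Z) mod 4 = \<alpha>"
    using z(2) by (simp only: ac_simps)
  have "(?Y + (?X + ?Z)) mod 4 = (?X + (?Y + ?Z)) mod 4"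
    by (simp only: ac_simps)
  also have "\<dots> = (?X + \<alpha>) mod 4"
    by (subst Z[symmetric]) (rule mod_add_right_eq[symmetric])
  also have "\<dots> = (?Y + \<beta>) mod 4"
    using y(2) by (simp only: ac_simps)
  finally have "(?X + ?Z) mod 4 = \<beta> mod 4"
    by (rule cong_add_lcancel_nat[unfolded cong_def, THEN iffD1])
  then have "digit_sum ?u mod 4 = \<alpha>" "digit_sum (?u + s) mod 4 = \<beta>"
    unfolding u3 u4 using Z assms(5) by (simp_all only: ac_simps mod_less)
  with u1 u2 show ?thesis by blast
qed

text \<open>Every carrying residue \<open>v\<close> and every \<open>q < 2 ^ (m - L)\<close> yield
  some \<open>u\<close>, from which \<open>v\<close> and \<open>q\<close> can be read off. With
  \<open>L\<close> the bit length of \<open>s\<close> these are \<open>s * 2 ^ (m - L)\<close>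
  pairs, at least half of \<open>2 ^ m\<close>.\<close>

lemma digit_sum_pairs_card:
  fixes s m :: nat
  assumes "0 < s" "s < 2 ^ m" "\<alpha> < 4" "\<beta> < 4"
  shows "2 ^ m \<le> 2 * card {u. 0 < u \<and> u < 2 ^ (m + 7) \<and>
    digit_sum u mod 4 = \<alpha> \<and> digit_sum (u + s) mod 4 = \<beta>}" (is "_ \<le> 2 * card ?U")
proof -
  define L where "L = (LEAST L. s < 2 ^ L)"
  have L: "s < 2 ^ L" "L \<le> m"
    unfolding L_def using assms(2) by (rule LeastI, intro Least_le)
  have "L \<noteq> 0"
    using L assms(1) by (intro notI) simp
  then have "\<not> s < 2 ^ (L - 1)"
    unfolding L_def by (intro not_less_Least) simp
  then have s: "2 ^ L \<le> 2 * s"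
    using \<open>L \<noteq> 0\<close> by (cases L) auto
  define V where "V = {2 ^ L - s..<2 ^ L} \<times> {..<(2::nat) ^ (m - L)}"
  have "V \<subseteq> (\<lambda>u. (u mod 2 ^ L, u div 2 ^ (L + 7))) ` ?U"
  proof
    fix p assume "p \<in> V"
    then obtain v q where p: "p = (v, q)" "2 ^ L - s \<le> v" "v < 2 ^ L" "q < 2 ^ (m - L)"
      by (auto simp: V_def)
    then obtain u where u: "u mod 2 ^ L = v" "u div 2 ^ (L + 7) = q"
        "digit_sum u mod 4 = \<alpha>" "digit_sum (u + s) mod 4 = \<beta>"
      using ex_digit_sums_in_block[OF L(1) _ p(3) assms(3,4), of q] by force
    have "0 < u"
      using u(1) p(2) L by (cases u) auto
    moreover have "u < 2 ^ (m + 7)"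
    proof -
      have "u < 2 ^ (m - L) * 2 ^ (L + 7)"
        using u(2) p(4) by (subst div_less_iff_less_mult[symmetric]) auto
      then show ?thesis
        using L by (simp flip: power_add)
    qed
    ultimately show "p \<in> (\<lambda>u. (u mod 2 ^ L, u div 2 ^ (L + 7))) ` ?U"
      using u p(1) by (intro image_eqI[of _ _ u]) auto
  qed
  moreover have "finite ?U"
    by (rule finite_subset[of _ "{..<2 ^ (m + 7)}"]) auto
  ultimately have "card V \<le> card ?U"
    by (rule surj_card_le[rotated])
  moreover have "card V = s * 2 ^ (m - L)"
    using L by (simp add: V_def)
  moreover have "2 ^ m \<le> 2 * s * 2 ^ (m - L)"
    using mult_right_mono[OF s, of "2 ^ (m - L)"] L by (simp flip: power_add)
  ultimately show ?thesis by simp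
qed

section \<open>The two colour classes on one level\<close>

definition base8 :: "bool \<Rightarrow> int set" where
  "base8 b = (if b then {0, 1, 3, 4} else {2, 5, 6, 7})"

lemma base8_sum: "\<exists>p\<in>base8 b. \<exists>q\<in>base8 b. (p + q) mod 8 = n mod 8"
proof -
  have "n mod 8 \<in> {0, 1, 2, 3, 4, 5, 6, 7}"
    using pos_mod_bound[of 8 n] pos_mod_sign[of 8 n] by auto
  then show ?thesis
    by (auto simp: base8_def)
qed

definition solid :: "bool \<Rightarrow> int set \<Rightarrow> int set" where
  "solid b I = {x \<in> I. x mod 8 \<in> base8 b}"

text \<open>Up to endpoints, the zones D, A, P, their images D', A', P' under
  \<open>x \<mapsto> 4 * M - x\<close> and the range of the core tile \<open>(M, 3 * M)\<close> in
  the order D, P', A, core, A', P, D'.\<close>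

definition zoneD :: "int \<Rightarrow> int set" where
  "zoneD M = {x. M < x \<and> 16 * x < 21 * M}"

definition zoneA :: "int \<Rightarrow> int set" where
  "zoneA M = {x. 3 * M < 2 * x \<and> 8 * x < 15 * M}"

definition zoneP :: "int \<Rightarrow> int set" where
  "zoneP M = {x. 5 * M < 2 * x \<and> 16 * x < 43 * M}"

text \<open>Digit sums 0, 1, 2, 3 modulo 4 stand for: upper element to True, upper to False, lower
  to True, lower to False.\<close>

definition core :: "bool \<Rightarrow> int \<Rightarrow> int set" where
  "core b M =
    {2 * M + int u | u. 8 * int u < M \<and> 0 < u \<and> digit_sum u mod 4 = (if b then 0 else 1)} \<union>
    {2 * M - int u | u. 8 * int u < M \<and> 0 < u \<and> digit_sum u mod 4 = (if b then 2 else 3)}"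

definition piece :: "bool \<Rightarrow> int \<Rightarrow> int set" where
  "piece b M = solid b (zoneD M \<union> zoneA M \<union> zoneP M) \<union> core b M"

lemma core_bounds: "x \<in> core b M \<Longrightarrow> 15 * M < 8 * x \<and> 8 * x < 17 * M"
  by (auto simp: core_def)

lemma piece_bounds: "x \<in> piece b M \<Longrightarrow> 0 < M \<Longrightarrow> M < x \<and> x < 3 * M"
  using core_bounds[of x b M] by (auto simp: piece_def solid_def zoneD_def zoneA_def zoneP_def)

lemma core_disjoint: "core True M \<inter> core False M = {}"
  by (auto simp: core_def)

lemma core_reflect: "x \<in> core b M \<Longrightarrow> 4 * M - x \<notin> core b' M"
  by (auto simp: core_def split: if_splits)

lemma piece_disjoint: "0 < M \<Longrightarrow> piece True M \<inter> piece False M = {}"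
  using core_bounds[of _ _ M] core_disjoint[of M]
  by (fastforce simp: piece_def solid_def zoneD_def zoneA_def zoneP_def base8_def)

lemma piece_reflect:
  assumes "x \<in> piece b M" "0 < M"
  shows "4 * M - x \<notin> piece b' M"
  using assms core_bounds[of x b M] core_bounds[of "4 * M - x" b' M] core_reflect[of x b M b']
  by (auto simp: piece_def solid_def zoneD_def zoneA_def zoneP_def)

section \<open>Counting representations\<close>

lemma card_le_r':
  assumes "\<And>a. a \<in> X \<Longrightarrow> a \<in> A \<and> int n - a \<in> A \<and> 0 < a \<and> 2 * a \<le> int n \<and> int n \<le> 101 * a"
  shows "card X \<le> r' A n"
proof -
  let ?R = "{(a, a'). a \<in> A \<and> a' \<in> A \<and> a + a' = int n \<and>
    real_of_int a' / real_of_int a \<in> {1..100}}"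
  \<comment> \<open>Finiteness matters because \<open>card\<close> of an infinite set is 0.\<close>
  have "?R \<subseteq> {0..int n} \<times> {0..int n}"
  proof
    fix p assume "p \<in> ?R"
    then obtain a a' where p: "p = (a, a')" "a + a' = int n" "1 \<le> real_of_int a' / real_of_int a"
      by auto
    have "0 < a \<and> a \<le> a'"
      using p(2,3) by (auto simp: le_divide_eq split: if_splits)
    then show "p \<in> {0..int n} \<times> {0..int n}"
      using p by auto
  qed
  then have "finite ?R"
    by (rule finite_subset) simp
  moreover have "(\<lambda>a. (a, int n - a)) ` X \<subseteq> ?R"
  proof
    fix p assume "p \<in> (\<lambda>a. (a, int n - a)) ` X"
    then obtain a where a: "a \<in> X" "p = (a, int n - a)" by auto
    have "1 \<le> real_of_int (int n - a) / real_of_int a" "real_of_int (int n - a) / real_of_int a \<le> 100"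
      using assms[OF a(1)] by (simp_all add: divide_simps)
    then show "p \<in> ?R"
      using assms[OF a(1)] a(2) by simp
  qed
  ultimately have "card ((\<lambda>a. (a, int n - a)) ` X) \<le> card ?R"
    by (rule card_mono)
  moreover have "card ((\<lambda>a. (a, int n - a)) ` X) = card X"
    by (intro card_image inj_onI) auto
  ultimately show ?thesis
    by (simp add: r'_def)
qed

text \<open>Among \<open>8 * t\<close> consecutive values of \<open>a\<close>, exactly
  \<open>t\<close> are congruent to \<open>p\<close> modulo 8, and then \<open>int n - a\<close> is
  congruent to \<open>q\<close>. The slack \<open>16 * int t\<close> at both ends keeps the summands
  in their intervals and ensures \<open>2 * a \<le> int n\<close>.\<close>

lemma r'_solid_ge:
  fixes l u l' u' :: int
  assumes A: "solid b {l<..<u} \<subseteq> A" "solid b {l'<..<u'} \<subseteq> A"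
    and "0 < t" "0 < l" "l \<le> l'" "u \<le> u'" "u' \<le> 100 * l"
    and "l + 8 * int t < u" "l' + 8 * int t < u'"
    and "l + l' + 16 * int t \<le> int n" "int n + 16 * int t \<le> u + u'"
  shows "t \<le> r' A n"
proof -
  obtain p q where pq: "p \<in> base8 b" "q \<in> base8 b" "(p + q) mod 8 = int n mod 8"
    using base8_sum by blast
  have small: "p mod 8 = p" "q mod 8 = q"
    using pq by (auto simp: base8_def split: if_splits)
  \<comment> \<open>\<open>x0\<close> is the least \<open>a\<close> with \<open>l < a\<close> and
    \<open>int n - a < u'\<close>.\<close>
  define x0 where "x0 = max (l + 1) (int n - u' + 1)"
  define x1 where "x1 = x0 + (p - x0) mod 8"
  have x1: "x0 \<le> x1" "x1 \<le> x0 + 7" "x1 mod 8 = p"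
    using small by (auto simp: x1_def mod_add_right_eq)
  let ?X = "(\<lambda>i. x1 + 8 * int i) ` {..<t}"
  have "card ?X \<le> r' A n"
  proof (rule card_le_r')
    fix a assume "a \<in> ?X"
    then obtain i where i: "i < t" "a = x1 + 8 * int i" by auto
    have a: "x0 \<le> a" "a \<le> x0 + 8 * int t - 1"
      using i x1(1,2) by auto
    have "a mod 8 = p"
      using i x1(3) by simp
    moreover have "(int n - a) mod 8 = (p + q - p) mod 8"
      using pq(3) small calculation by (intro mod_diff_cong) simp_all
    then have "(int n - a) mod 8 = q"
      using small by simp
    moreover have "l < a" "a < u" "l' < int n - a" "int n - a < u'" "2 * a \<le> int n"
      using a assms(3-) by (auto simp: x0_def max_def split: if_splits)
    ultimately have "a \<in> solid b {l<..<u}" "int n - a \<in> solid b {l'<..<u'}"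
      using pq by (auto simp: solid_def)
    with A \<open>l < a\<close> \<open>int n - a < u'\<close> \<open>2 * a \<le> int n\<close> assms(4,7)
    show "a \<in> A \<and> int n - a \<in> A \<and> 0 < a \<and> 2 * a \<le> int n \<and> int n \<le> 101 * a"
      by auto
  qed
  moreover have "card ?X = t"
    by (subst card_image) (auto simp: inj_on_def)
  ultimately show ?thesis by simp
qed

lemma piece_solid_subsets:
  assumes "piece b (16 * m) \<subseteq> A"
  shows "solid b {16 * m<..<21 * m} \<subseteq> A" "solid b {24 * m<..<30 * m} \<subseteq> A"
    "solid b {40 * m<..<43 * m} \<subseteq> A"
  using assms by (auto simp: piece_def solid_def zoneD_def zoneA_def zoneP_def)

lemma r'_pieces_ge:
  assumes A: "piece b (16384 * int t) \<subseteq> A" "piece b (65536 * int t) \<subseteq> A"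
      "piece b (262144 * int t) \<subseteq> A"
    and t: "0 < t"
    and n: "139264 * int t \<le> int n" "int n < 557056 * int t"
      "\<bar>int n - 262144 * int t\<bar> \<ge> 32 * int t"
  shows "t \<le> r' A n"
proof -
  note Z = piece_solid_subsets[of b "1024 * int t" A, simplified, OF A(1)]
    piece_solid_subsets[of b "4096 * int t" A, simplified, OF A(2)]
    piece_solid_subsets[of b "16384 * int t" A, simplified, OF A(3)]
  \<comment> \<open>With \<open>M = 65536 * int t\<close>, each case uses a sum of two zones. D + P
    ends and A + P begins exactly at \<open>4 * M\<close>, hence the excluded window. Case 6 pairs
    level \<open>M / 4\<close> with level \<open>4 * M\<close> to bridge the hole between A + P and
    the sums of D with the D of level \<open>4 * M\<close>.\<close>
  consider "int n \<le> 172000 * int t" | "172000 * int t < int n" "int n \<le> 208000 * int t"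
    | "208000 * int t < int n" "int n \<le> 245000 * int t"
    | "245000 * int t < int n" "int n \<le> 262128 * int t"
    | "262160 * int t \<le> int n" "int n \<le> 298000 * int t"
    | "298000 * int t < int n" "int n \<le> 365000 * int t"
    | "365000 * int t < int n" "int n \<le> 430000 * int t"
    | "430000 * int t < int n" "int n \<le> 466000 * int t"
    | "466000 * int t < int n"
    using n t by linarith
  then show ?thesis
  proof cases
    case 1 show ?thesis
      by (rule r'_solid_ge[OF Z(4) Z(4)]) (use 1 n t in auto)
  next
    case 2 show ?thesis
      by (rule r'_solid_ge[OF Z(4) Z(5)]) (use 2 n t in auto)
  next
    case 3 show ?thesis
      by (rule r'_solid_ge[OF Z(5) Z(5)]) (use 3 n t in auto)
  next
    case 4 show ?thesis
      by (rule r'_solid_ge[OF Z(4) Z(6)]) (use 4 n t in auto)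
  next
    case 5 show ?thesis
      by (rule r'_solid_ge[OF Z(5) Z(6)]) (use 5 n t in auto)
  next
    case 6 show ?thesis
      by (rule r'_solid_ge[OF Z(1) Z(7)]) (use 6 n t in auto)
  next
    case 7 show ?thesis
      by (rule r'_solid_ge[OF Z(4) Z(7)]) (use 7 n t in auto)
  next
    case 8 show ?thesis
      by (rule r'_solid_ge[OF Z(5) Z(7)]) (use 8 n t in auto)
  next
    case 9 show ?thesis
      by (rule r'_solid_ge[OF Z(4) Z(8)]) (use 9 n t in auto)
  qed
qed

text \<open>For \<open>s > 0\<close> split \<open>n\<close> as
  \<open>(2 * M - u) + (2 * M + u + s)\<close>, for \<open>s < 0\<close> as
  \<open>(2 * M - u + s) + (2 * M + u)\<close>. Membership prescribes the digit sums of
  \<open>u\<close> and \<open>u + \<bar>s\<bar>\<close> modulo 4, so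
  \<open>digit_sum_pairs_card\<close> counts the good \<open>u\<close>.\<close>

lemma r'_core_ge:
  assumes A: "core b (2 ^ (m + 11)) \<subseteq> A"
    and s: "int n = 2 ^ (m + 13) + s" "s \<noteq> 0" "\<bar>s\<bar> < 2 ^ m"
  shows "2 ^ m \<le> 2 * r' A n"
proof -
  define M :: int where "M = 2 ^ (m + 11)"
  define \<sigma> where "\<sigma> = nat \<bar>s\<bar>"
  define p q :: nat where "p = (if b then 0 else 1)" and "q = (if b then 2 else 3)"
  have M: "M = 2048 * 2 ^ m" "int n = 4 * M + s"
    using s by (simp_all add: M_def power_add)
  have core: "2 * M + int u \<in> A" if "0 < u" "8 * int u < M" "digit_sum u mod 4 = p" for u
    using that A by (auto simp: core_def M_def p_def)
  have core': "2 * M - int u \<in> A" if "0 < u" "8 * int u < M" "digit_sum u mod 4 = q" for u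
    using that A by (auto simp: core_def M_def q_def)
  have \<sigma>: "0 < \<sigma>" "int \<sigma> < 2 ^ m"
    using s by (auto simp: \<sigma>_def)
  then have \<sigma>m: "\<sigma> < 2 ^ m"
    by (metis of_nat_less_iff of_nat_numeral of_nat_power)
  define \<alpha> \<beta> where "\<alpha> = (if s > 0 then q else p)" and "\<beta> = (if s > 0 then p else q)"
  let ?U = "{u. 0 < u \<and> u < 2 ^ (m + 7) \<and> digit_sum u mod 4 = \<alpha> \<and> digit_sum (u + \<sigma>) mod 4 = \<beta>}"
  define f where "f u = (if s > 0 then 2 * M - int u else 2 * M - int (u + \<sigma>))" for u
  have "2 ^ m \<le> 2 * card ?U"
    using \<sigma>(1) \<sigma>m by (intro digit_sum_pairs_card) (auto simp: \<alpha>_def \<beta>_def p_def q_def)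
  also have "card ?U = card (f ` ?U)"
    by (rule card_image[symmetric]) (auto simp: inj_on_def f_def split: if_splits)
  also have "card (f ` ?U) \<le> r' A n"
  proof (rule card_le_r')
    fix a assume "a \<in> f ` ?U"
    then obtain u where u: "a = f u" "0 < u" "u < 2 ^ (m + 7)"
      "digit_sum u mod 4 = \<alpha>" "digit_sum (u + \<sigma>) mod 4 = \<beta>" by auto
    \<comment> \<open>Since \<open>2 ^ (m + 7) = M / 16\<close>, there is room for
      \<open>u + \<sigma>\<close> below \<open>M / 8\<close>.\<close>
    have "int u < 2 ^ (m + 7)"
      using u(3) by (metis of_nat_less_iff of_nat_numeral of_nat_power)
    then have small: "16 * int u < M"
      using M(1) by (simp add: power_add)
    have small': "2048 * int \<sigma> < M"
      using M(1) \<sigma>(2) by simp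
    show "a \<in> A \<and> int n - a \<in> A \<and> 0 < a \<and> 2 * a \<le> int n \<and> int n \<le> 101 * a"
    proof (cases "s > 0")
      case True
      then have e: "a = 2 * M - int u" "int n - a = 2 * M + int (u + \<sigma>)" "s = int \<sigma>"
        using u(1) M(2) by (simp_all add: f_def \<sigma>_def)
      have "2 * M - int u \<in> A" "2 * M + int (u + \<sigma>) \<in> A"
        using True u small small' by (intro core core'; simp add: \<alpha>_def \<beta>_def)+
      then have "a \<in> A" "int n - a \<in> A"
        by (simp only: e(1), simp only: e(2))
      with e small small' M(2) show ?thesis by auto
    next
      case False
      then have e: "a = 2 * M - int (u + \<sigma>)" "int n - a = 2 * M + int u" "s = - int \<sigma>"
        using u(1) M(2) by (simp_all add: f_def \<sigma>_def)
      have "2 * M - int (u + \<sigma>) \<in> A" "2 * M + int u \<in> A"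
        using False u small small' by (intro core core'; simp add: \<alpha>_def \<beta>_def)+
      then have "a \<in> A" "int n - a \<in> A"
        by (simp only: e(1), simp only: e(2))
      with e small small' M(2) show ?thesis by auto
    qed
  qed
  finally show ?thesis by simp
qed

section \<open>The lower bound for all large \<open>n\<close>\<close>

lemma N_Suc: "N (Suc k) = 4 * N k"
  by (simp add: N_def)

lemma N_pos: "0 < N k"
  by (simp add: N_def)

lemma N_mono: "i \<le> j \<Longrightarrow> N i \<le> N j"
  by (simp add: N_def power_increasing)

lemma h_le_r':
  assumes A: "\<And>k. k \<ge> 1 \<Longrightarrow> piece b (N k) \<subseteq> A"
    and n: "17 * N 7 \<le> 8 * int n" "int n \<notin> {N i | i. i \<ge> 1}"
  shows "h n \<le> int (r' A n)"
proof -
  have "\<exists>k. 8 * int n < 17 * N (Suc k)"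
  proof
    have "int n < 2 ^ n" by simp
    also have "\<dots> \<le> (4::int) ^ n" by (rule power_mono) auto
    finally have "int n < 4 ^ n" .
    moreover have "N (Suc n) = 16 * 4 ^ n"
      by (simp add: N_def)
    ultimately show "8 * int n < 17 * N (Suc n)"
      by linarith
  qed
  \<comment> \<open>The ranges \<open>17 * N k \<le> 8 * n < 17 * N (k + 1)\<close> are those of
    \<open>r'_pieces_ge\<close> with \<open>N k = 65536 * t\<close>; \<open>7 \<le> k\<close> makes
    \<open>t = 4 ^ (k - 7)\<close> an integer.\<close>
  define k where "k = (LEAST k. 8 * int n < 17 * N (Suc k))"
  have k1: "8 * int n < 17 * N (Suc k)"
    unfolding k_def by (rule LeastI_ex) fact
  have "7 \<le> k"
  proof (rule ccontr)
    assume "\<not> 7 \<le> k"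
    then have "N (Suc k) \<le> N 7" by (intro N_mono) simp
    with k1 n show False by simp
  qed
  then obtain j where k: "k = Suc (j + 6)"
    by (metis add.commute add_Suc_right le_Suc_ex numeral_nat(7) add_Suc eval_nat_numeral(3))
  have "\<not> 8 * int n < 17 * N (Suc (j + 6))"
    unfolding k by (metis k k_def lessI not_less_Least)
  moreover have "Suc (j + 6) = j + 7" by simp
  ultimately have k2: "17 * N (j + 7) \<le> 8 * int n"
    by (simp only: not_less)
  define t :: nat where "t = 4 ^ j"
  have N: "N (j + 6) = 16384 * int t" "N (j + 7) = 65536 * int t" "N (j + 8) = 262144 * int t"
    by (simp_all add: N_def t_def power_add)
  have t: "0 < t" by (simp add: t_def)
  have A': "piece b (16384 * int t) \<subseteq> A" "piece b (65536 * int t) \<subseteq> A"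
      "piece b (262144 * int t) \<subseteq> A"
    using A[of "j + 6"] A[of "j + 7"] A[of "j + 8"] by (simp_all add: N)
  have n1: "139264 * int t \<le> int n"
    using k2 N by simp
  have n2: "int n < 557056 * int t"
    using k1 N by (simp add: k N_Suc eval_nat_numeral)
  have "t \<le> r' A n"
  proof (cases "\<bar>int n - 262144 * int t\<bar> \<ge> 32 * int t")
    case True
    then show ?thesis
      using r'_pieces_ge A' t n1 n2 by blast
  next
    case False
    have e: "(2::int) ^ (2 * j + 5) = 32 * int t"
      by (simp add: t_def power_add power_mult)
    have "2 ^ (2 * j + 5) \<le> 2 * r' A n"
    proof (rule r'_core_ge)
      have "(2::int) ^ (2 * j + 5 + 11) = 65536 * int t"
        by (simp add: t_def power_add power_mult)
      then show "core b (2 ^ (2 * j + 5 + 11)) \<subseteq> A"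
        using A'(2) by (auto simp: piece_def)
      show "int n = 2 ^ (2 * j + 5 + 13) + (int n - 262144 * int t)"
        by (simp add: t_def power_add power_mult)
      have "int n \<noteq> N (j + 8)"
        using n(2) by auto
      then show "int n - 262144 * int t \<noteq> 0"
        using N(3) by simp
      show "\<bar>int n - 262144 * int t\<bar> < 2 ^ (2 * j + 5)"
        using False e by simp
    qed
    moreover have "(2::nat) ^ (2 * j + 5) = 32 * t"
      by (simp add: t_def power_add power_mult)
    ultimately show ?thesis by simp
  qed
  moreover have "h n \<le> int t"
  proof -
    \<comment> \<open>The bound suffices because \<open>557056 < 10 ^ 8\<close>.\<close>
    have "real n < 557056 * real t"
      using n2 by (metis of_int_less_iff of_int_mult of_int_numeral of_int_of_nat_eq)
    then have "real n * 10 powi (-8) \<le> real t"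
      by (simp add: power_int_minus divide_simps)
    then show ?thesis
      unfolding h_def by linarith
  qed
  ultimately show ?thesis by linarith
qed

section \<open>Playing against the selection mechanism\<close>

text \<open>The recursion builds tables \<open>P k\<close> whose entries up to \<open>k\<close> are
  final and whose later ones are still empty. As \<open>S\<close> reads earlier entries only, the
  unfinished table may be replaced by the completed sequences.\<close>

lemma selection_outputs_exist:
  assumes "selection_mechanism S"
  shows "\<exists>G H. \<forall>k\<ge>1. (G k, H k) = S k B C G H"
proof -
  define P :: "nat \<Rightarrow> nat \<Rightarrow> int set \<times> int set" where
    "P = rec_nat (\<lambda>_. ({}, {})) (\<lambda>k p. p(Suc k := S (Suc k) B C (fst \<circ> p) (snd \<circ> p)))"
  have P: "P (Suc k) = (P k)(Suc k := S (Suc k) B C (fst \<circ> P k) (snd \<circ> P k))" for k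
    by (simp add: P_def)
  have stable: "i \<le> k \<Longrightarrow> P k i = P i i" for i k
    by (induction k) (auto simp: P le_Suc_eq)
  define G H where "G k = fst (P k k)" and "H k = snd (P k k)" for k
  have "(G k, H k) = S k B C G H" if "k \<ge> 1" for k
  proof -
    obtain j where j: "k = Suc j" using \<open>k \<ge> 1\<close> by (cases k) auto
    have "S k B C (fst \<circ> P j) (snd \<circ> P j) = S k B C G H"
      using assms \<open>k \<ge> 1\<close> stable[of _ j] unfolding selection_mechanism_def
      by (elim conjE allE[of _ k]) (simp add: j G_def H_def)
    then show ?thesis
      by (simp add: G_def H_def j P)
  qed
  then show ?thesis by blast
qed

theorem theorem2:
  fixes S :: selection
  assumes "selection_mechanism S"
    and "\<And>k B C G H. k \<ge> 1 \<Longrightarrow> fst (S k B C G H) \<inter> snd (S k B C G H) = {}"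
    and "\<And>k B C G H x. k \<ge> 1 \<Longrightarrow> x \<in> fst (S k B C G H) \<union> snd (S k B C G H) \<Longrightarrow> x \<le> N k"
  shows "\<exists>B C G H :: nat \<Rightarrow> int set.
    (\<forall>k\<ge>1. (G k, H k) = S k B C G H) \<and>
    (let BB = assemble {1..} B G; CC = assemble {1..} C H in
      (\<forall>k\<ge>1. \<forall>x \<in> B k \<union> C k. 0 < x \<and> N k < x \<and> x < N (k + 1)) \<and>
      BB \<inter> CC = {} \<and>
      (\<forall>\<^sub>F n in sequentially. int n \<notin> {N i | i. i \<ge> 1} \<longrightarrow>
         int (r' BB n) \<ge> h n \<and> int (r' CC n) \<ge> h n) \<and>
      (\<forall>\<^sub>F k in sequentially. \<forall>a \<in> BB \<union> CC. \<forall>a' \<in> BB \<union> CC.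
         N (k + 1) = a + a' \<longrightarrow> a \<in> G k \<union> H k \<or> a' \<in> G k \<union> H k))"
proof -
  define B C where "B k = piece True (N k)" and "C k = piece False (N k)" for k
  obtain G H where GH: "\<And>k. k \<ge> 1 \<Longrightarrow> (G k, H k) = S k B C G H"
    using selection_outputs_exist[OF assms(1)] by metis
  have GH': "G k = fst (S k B C G H)" "H k = snd (S k B C G H)" if "k \<ge> 1" for k
    using GH[OF that] by (metis fst_conv, metis snd_conv)
  have disj: "G k \<inter> H k = {}" and le: "x \<in> G k \<union> H k \<Longrightarrow> x \<le> N k" if "k \<ge> 1" for k x
    using assms(2,3) that GH'[OF that] by metis+
  define BB CC where "BB = assemble {1..} B G" and "CC = assemble {1..} C H"
  have BC: "N k < x \<and> x < 3 * N k" if "x \<in> B k \<union> C k" for k x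
    using that piece_bounds N_pos by (auto simp: B_def C_def)
  \<comment> \<open>Such an \<open>x\<close> comes from an earlier level, as an element of a piece
    or as \<open>4 * N i - g\<close> with \<open>g \<le> N i\<close>. Positivity puts the
    reflections of level \<open>k\<close> strictly below \<open>4 * N k\<close>.\<close>
  have pos: "0 < x" if x: "x \<in> G k \<union> H k" and k: "k \<ge> 1" for k x
  proof -
    have "G k \<subseteq> assemble {1..<k} B G" "H k \<subseteq> assemble {1..<k} C H"
      using assms(1) k unfolding selection_mechanism_def GH'[OF k] by simp_all
    with x have "x \<in> assemble {1..<k} B G \<or> x \<in> assemble {1..<k} C H"
      by blast
    then obtain i where i: "i \<ge> 1" "x \<in> B i \<union> C i \<or> (\<exists>g\<in>G i \<union> H i. x = N (i + 1) - g)"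
      unfolding assemble_def reflect_def by (elim disjE UN_E) auto
    then show ?thesis
      using BC[of x i] le[OF i(1)] N_pos[of i] by (force simp: N_Suc)
  qed
  have cases_BB: "\<exists>i\<ge>1. (x \<in> B i \<and> N i < x \<and> x < 3 * N i) \<or>
      (\<exists>g\<in>G i. x = 4 * N i - g \<and> 3 * N i \<le> x \<and> x < 4 * N i)" if "x \<in> BB" for x
  proof -
    from that obtain i where "i \<ge> 1" "x \<in> B i \<or> (\<exists>g\<in>G i. x = 4 * N i - g)"
      unfolding BB_def assemble_def reflect_def by (auto simp: N_Suc)
    then show ?thesis
      using BC[of x i] le[of i] pos[of _ i] by fastforce
  qed
  have cases_CC: "\<exists>i\<ge>1. (x \<in> C i \<and> N i < x \<and> x < 3 * N i) \<or>
      (\<exists>g\<in>H i. x = 4 * N i - g \<and> 3 * N i \<le> x \<and> x < 4 * N i)" if "x \<in> CC" for x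
  proof -
    from that obtain i where "i \<ge> 1" "x \<in> C i \<or> (\<exists>g\<in>H i. x = 4 * N i - g)"
      unfolding CC_def assemble_def reflect_def by (auto simp: N_Suc)
    then show ?thesis
      using BC[of x i] le[of i] pos[of _ i] by fastforce
  qed
  have level: "i = j" if "N i < x" "x < 4 * N i" "N j < x" "x < 4 * N j" for i j x
  proof (rule ccontr)
    assume "i \<noteq> j"
    then have "Suc i \<le> j \<or> Suc j \<le> i" by auto
    then have "4 * N i \<le> N j \<or> 4 * N j \<le> N i"
      using N_mono[of "Suc i" j] N_mono[of "Suc j" i] by (auto simp: N_Suc)
    with that show False by auto
  qed
  have "BB \<inter> CC = {}"
  proof (rule ccontr)
    assume "BB \<inter> CC \<noteq> {}"
    then obtain x where x: "x \<in> BB" "x \<in> CC" by blast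
    obtain i where i: "i \<ge> 1" "(x \<in> B i \<and> N i < x \<and> x < 3 * N i) \<or>
      (\<exists>g\<in>G i. x = 4 * N i - g \<and> 3 * N i \<le> x \<and> x < 4 * N i)"
      using cases_BB[OF x(1)] by blast
    obtain j where j: "j \<ge> 1" "(x \<in> C j \<and> N j < x \<and> x < 3 * N j) \<or>
      (\<exists>g\<in>H j. x = 4 * N j - g \<and> 3 * N j \<le> x \<and> x < 4 * N j)"
      using cases_CC[OF x(2)] by blast
    have "i = j"
      using i(2) j(2) N_pos[of i] N_pos[of j] by (intro level[of i x j]) auto
    moreover have "B i \<inter> C i = {}"
      unfolding B_def C_def by (rule piece_disjoint[OF N_pos])
    ultimately show False
      using i(2) j(2) disj[OF i(1)] by auto
  qed
  \<comment> \<open>The larger summand is at least \<open>2 * N k\<close>, hence of level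
    \<open>k\<close>. Below \<open>3 * N k\<close> it would force both summands into pieces of level
    \<open>k\<close>, against \<open>piece_reflect\<close>; otherwise it is a reflection
    \<open>4 * N k - g\<close>, and \<open>a = g\<close>.\<close>
  moreover have "a \<in> G k \<union> H k" if k: "k \<ge> 1" and a: "a \<in> BB \<union> CC" "a' \<in> BB \<union> CC"
      and sum: "4 * N k = a + a'" and "a \<le> a'" for k a a'
  proof -
    have cases_un: "\<exists>i\<ge>1. (x \<in> B i \<union> C i \<and> N i < x \<and> x < 3 * N i) \<or>
      (\<exists>g\<in>G i \<union> H i. x = 4 * N i - g \<and> 3 * N i \<le> x \<and> x < 4 * N i)" if "x \<in> BB \<union> CC" for x
      using that cases_BB[of x] cases_CC[of x] by blast
    obtain i where i: "i \<ge> 1" "(a \<in> B i \<union> C i \<and> N i < a \<and> a < 3 * N i) \<or>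
      (\<exists>g\<in>G i \<union> H i. a = 4 * N i - g \<and> 3 * N i \<le> a \<and> a < 4 * N i)"
      using cases_un[OF a(1)] by blast
    obtain j where j: "j \<ge> 1" "(a' \<in> B j \<union> C j \<and> N j < a' \<and> a' < 3 * N j) \<or>
      (\<exists>g\<in>G j \<union> H j. a' = 4 * N j - g \<and> 3 * N j \<le> a' \<and> a' < 4 * N j)"
      using cases_un[OF a(2)] by blast
    have "0 < a" using i(2) N_pos[of i] by auto
    then have "j = k"
      using j(2) N_pos[of j] N_pos[of k] sum \<open>a \<le> a'\<close> by (intro level[of j a' k]) auto
    show ?thesis
    proof (cases "a' < 3 * N k")
      case True
      then have a': "a' \<in> B k \<union> C k" "N k < a'"
        using j(2) \<open>j = k\<close> by auto
      then have "i = k"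
        using i(2) N_pos[of i] N_pos[of k] sum \<open>a \<le> a'\<close> True by (intro level[of i a k]) auto
      then have "4 * N k - a' \<in> B k \<union> C k"
        using i(2) sum \<open>a \<le> a'\<close> a'(2) N_pos[of k] by auto
      then show ?thesis
        using a'(1) piece_reflect[OF _ N_pos] unfolding B_def C_def by blast
    next
      case False
      then show ?thesis
        using j(2) \<open>j = k\<close> sum by auto
    qed
  qed
  then have "\<forall>k\<ge>1. \<forall>a \<in> BB \<union> CC. \<forall>a' \<in> BB \<union> CC.
      N (k + 1) = a + a' \<longrightarrow> a \<in> G k \<union> H k \<or> a' \<in> G k \<union> H k"
    by (metis N_Suc Suc_eq_plus1 add.commute linear)
  then have "\<forall>\<^sub>F k in sequentially. \<forall>a \<in> BB \<union> CC. \<forall>a' \<in> BB \<union> CC.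
      N (k + 1) = a + a' \<longrightarrow> a \<in> G k \<union> H k \<or> a' \<in> G k \<union> H k"
    unfolding eventually_sequentially by blast
  moreover have "\<forall>\<^sub>F n in sequentially. int n \<notin> {N i | i. i \<ge> 1} \<longrightarrow>
      int (r' BB n) \<ge> h n \<and> int (r' CC n) \<ge> h n"
    unfolding eventually_sequentially
  proof (intro exI allI impI)
    fix n assume n: "nat (17 * N 7) \<le> n" "int n \<notin> {N i | i. i \<ge> 1}"
    have "piece True (N k) \<subseteq> BB" "piece False (N k) \<subseteq> CC" if "k \<ge> 1" for k
      using that by (auto simp: BB_def CC_def assemble_def B_def C_def)
    moreover have "17 * N 7 \<le> 8 * int n"
      using n(1) by linarith
    ultimately show "int (r' BB n) \<ge> h n \<and> int (r' CC n) \<ge> h n"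
      using h_le_r' n(2) by blast
  qed
  moreover have "\<forall>k\<ge>1. \<forall>x \<in> B k \<union> C k. 0 < x \<and> N k < x \<and> x < N (k + 1)"
    using BC N_pos by (fastforce simp: N_Suc)
  ultimately show ?thesis
    using GH unfolding BB_def CC_def Let_def by blast
qed

end
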